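(* For every integer $n \ge 0$, the relation $\Vdash_n$ is a partial ordering on $\{1,\dots,2^n\}$. For every $p \in \{1,\dots,2^n\}$ we have $1 \Vdash_n p$ and $p \Vdash_n 2^n$; that is, $1$ is initial and $2^n$ is final for $\Vdash_n$.
   Context: For $n \ge 0$, the $n$th Laver table is the set $A_n = \{1,\dots,2^n\}$ equipped with the unique binary operation $\triangleright_n$ such that, for all $x,y$, $x \triangleright_n 1 = (x+1) \bmod 2^n$ and $x \triangleright_n (y \triangleright_n 1) = (x \triangleright_n y) \triangleright_n (x \triangleright_n 1)$, where $a \bmod m$ denotes the unique integer in $\{1,\dots,m\}$ congruent to $a$ modulo $m$. (By a known theorem of Laver this operation exists, is unique, and satisfies the left-selfdistributivity law $x \triangleright (y \triangleright z) = (x \triangleright y) \triangleright (x \triangleright z)$.) For $q,r \in A_n$, write $q \Vdash_n r$ if there exists $p \in A_n$ with $p \triangleright_n q = r$. "Partial ordering" means a reflexive, antisymmetric, transitive relation. *)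

theory Defs
  imports Main "HOL-Library.FuncSet" "HOL-Number_Theory.Cong"
begin

definition pmod :: "nat \<Rightarrow> nat \<Rightarrow> nat" (infixl \<open>pmod\<close> 70) where
  "a pmod m = (if a mod m = 0 then m else a mod m)"

lemma pmod_iff:
  assumes "m > 0"
  shows "r = a pmod m \<longleftrightarrow> r \<in> {1..m} \<and> [r = a] (mod m)"
proof (cases "r = m")
  case True
  then show ?thesis using assms mod_less_divisor[OF assms, of a]
    by (auto simp: pmod_def cong_def)
next
  case False
  then show ?thesis using assms mod_less_divisor[OF assms, of a]
    by (auto simp: pmod_def cong_def)
qed

definition laver_carrier :: "nat \<Rightarrow> nat set" where
  "laver_carrier n = {1..2 ^ n}"

definition is_laver_op :: "nat \<Rightarrow> (nat \<Rightarrow> nat \<Rightarrow> nat) \<Rightarrow> bool" where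
  "is_laver_op n f \<longleftrightarrow>
     f \<in> laver_carrier n \<rightarrow>\<^sub>E laver_carrier n \<rightarrow>\<^sub>E laver_carrier n \<and>
     (\<forall>x \<in> laver_carrier n. f x 1 = (x + 1) pmod 2 ^ n) \<and>
     (\<forall>x \<in> laver_carrier n. \<forall>y \<in> laver_carrier n. f x (f y 1) = f (f x y) (f x 1))"

text \<open>
  The extensional function space fixes the values outside the carrier, so that
  uniqueness of the operation on the carrier is uniqueness of the HOL function.
\<close>

definition laver_op :: "nat \<Rightarrow> nat \<Rightarrow> nat \<Rightarrow> nat" where
  "laver_op n = (THE f. is_laver_op n f)"

definition laver_rel :: "nat \<Rightarrow> (nat \<times> nat) set" where
  "laver_rel n = {(q, r). q \<in> laver_carrier n \<and> r \<in> laver_carrier n \<and>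
     (\<exists>p \<in> laver_carrier n. laver_op n p q = r)}"

end

theory Submission
  imports Defs
begin

text \<open>
  Rows of the table are computed by descending recursion on the row index: row \<open>x\<close> increases
  strictly from \<open>x + 1\<close> until it hits \<open>2 ^ n\<close> and is periodic from there on. Comparing the tables
  of sizes \<open>2 ^ n\<close> and \<open>2 ^ (n + 1)\<close> modulo \<open>2 ^ n\<close> shows that every period is a power of two that
  either stays the same or doubles; this gives existence of the operation, and selfdistributivity
  follows. Transitivity of right divisibility comes from the composition
  \<open>u = x \<triangleright> (y + 1) - 1\<close>, for which \<open>u \<triangleright> z = x \<triangleright> (y \<triangleright> z)\<close>.

  For antisymmetry, projecting to the table of half the size \<open>N\<close> leaves the case
  \<open>s \<triangleright> (q + N) = q\<close> with \<open>q \<le> N\<close>. Periodicity gives \<open>s \<triangleright> q = q\<close> with \<open>s < q\<close>, and the largest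
  \<open>e < 2 N\<close> with \<open>e \<triangleright> q = q\<close> is idempotent for composition. But the idempotents other than
  \<open>2 ^ m\<close> in the table of size \<open>2 ^ m\<close> are all of the form \<open>2 ^ m - 2 ^ j\<close>, hence \<open>e \<ge> N \<ge> q\<close>,
  contradicting \<open>e \<triangleright> q > e\<close>.
\<close>

section \<open>Residues in \<open>{1..m}\<close>\<close>

lemma pmod_bounds: "0 < m \<Longrightarrow> 0 < a pmod m" "0 < m \<Longrightarrow> a pmod m \<le> m"
  by (auto simp: pmod_def less_imp_le)

lemma pmod_mod [simp]: "(a pmod m) mod m = a mod m"
  by (simp add: pmod_def)

lemma pmod_cong: "a mod m = b mod m \<Longrightarrow> a pmod m = b pmod m"
  by (simp add: pmod_def)

lemma pmod_id: "0 < a \<Longrightarrow> a \<le> m \<Longrightarrow> a pmod m = a"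
  by (cases "a = m") (auto simp: pmod_def)

lemma pmod_pmod_dvd: "k dvd m \<Longrightarrow> (a pmod m) pmod k = a pmod k"
  by (rule pmod_cong) (metis mod_mod_cancel pmod_mod)

lemma pmod_above: "N < v \<Longrightarrow> v \<le> 2 * N \<Longrightarrow> v = N + v pmod N"
  using pmod_id[of "v - N" N] pmod_cong[of v N "v - N"] by (simp add: le_mod_geq)

text \<open>
  The columns are indexed by all naturals, column 0 being identified with column \<open>M\<close>, so that
  periodicity can be stated without reduction. The guard \<open>lav M x y \<le> x\<close> never
  holds and only serves termination.
\<close>

function lav :: "nat \<Rightarrow> nat \<Rightarrow> nat \<Rightarrow> nat" where
  "lav M x y = (if M \<le> x then y pmod M else if y = 0 then M else
     if lav M x (y - 1) \<le> x then 0 else lav M (lav M x (y - 1)) (x + 1))"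
  by pat_completeness auto
termination
  by (relation "measures [\<lambda>(M, x, y). M - x, \<lambda>(M, x, y). y]") auto

declare lav.simps [simp del]

section \<open>Growth and periodicity of rows\<close>

lemma lav_top: "lav M M y = y pmod M"
  by (simp add: lav.simps)

lemma lav_0: "x \<le> M \<Longrightarrow> lav M x 0 = M"
  by (auto simp: lav.simps pmod_def)

text \<open>Induction along the recursion: each new entry is taken from row \<open>?z\<close>, which
  lies beyond row \<open>x\<close>.\<close>

lemma lav_bounds: "x < M \<Longrightarrow> x < lav M x y \<and> lav M x y \<le> M"
proof (induction "M - x" arbitrary: x y rule: less_induct)
  case less
  note outer = less
  show ?case
  proof (induction y)
    case 0
    then show ?case using outer by (simp add: lav_0)
  next
    case (Suc y)
    let ?z = "lav M x y"
    have eq: "lav M x (Suc y) = lav M ?z (x + 1)"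
      using Suc outer(2) by (simp add: lav.simps[of M x "Suc y"])
    show ?case
    proof (cases "?z = M")
      case True
      then show ?thesis using eq outer(2) by (simp add: lav_top pmod_id)
    next
      case False
      then show ?thesis using eq Suc outer(1)[of ?z "x + 1"] outer(2) by fastforce
    qed
  qed
qed

lemma lav_greater: "x < M \<Longrightarrow> x < lav M x y"
  and lav_le: "0 < M \<Longrightarrow> x \<le> M \<Longrightarrow> lav M x y \<le> M"
  and lav_pos: "0 < M \<Longrightarrow> x \<le> M \<Longrightarrow> 0 < lav M x y"
  using lav_bounds[of x M y] pmod_bounds[of M y] by (auto simp: lav_top le_less)

lemma lav_Suc: "x < M \<Longrightarrow> lav M x (Suc y) = lav M (lav M x y) (x + 1)"
  using lav_greater[of x M y] by (simp add: lav.simps[of M x "Suc y"])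

lemma lav_1: "x < M \<Longrightarrow> lav M x (Suc 0) = x + 1"
  by (simp add: lav_Suc lav_0 lav_top pmod_id)

lemma lav_add_period:
  assumes "x < M" "lav M x m = M"
  shows "lav M x (m + k) = lav M x k"
  using assms by (induction k) (auto simp: lav_0 lav_Suc)

lemma lav_add_period_mult:
  assumes "x < M" "lav M x m = M"
  shows "lav M x (c * m + k) = lav M x k"
  using lav_add_period[OF assms] by (induction c) (auto simp: add.assoc)

lemma lav_period_dvd:
  assumes "x < M" "lav M x m = M" "m dvd k"
  shows "lav M x (k + l) = lav M x l"
  using lav_add_period_mult[OF assms(1,2)] assms(3) by (metis dvd_def mult.commute)

lemma lav_period_dvd_top:
  assumes "x < M" "lav M x m = M" "m dvd k"
  shows "lav M x k = M"
  using lav_period_dvd[OF assms, of 0] assms(1) by (simp add: lav_0)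

lemma lav_increasing:
  assumes "x < M" "0 < m" "\<And>k. 0 < k \<Longrightarrow> k < m \<Longrightarrow> lav M x k \<noteq> M"
  shows "x + m \<le> lav M x m"
  using assms(2,3)
proof (induction m)
  case (Suc m)
  show ?case
  proof (cases "m = 0")
    case True
    then show ?thesis using assms(1) by (simp add: lav_1)
  next
    case False
    then have "lav M x m < M"
      using Suc.prems(2)[of m] lav_le[of M x m] assms(1) by fastforce
    from lav_greater[OF this, of "x + 1"] show ?thesis
      using False Suc assms(1) by (force simp: lav_Suc)
  qed
qed simp

text \<open>By \<open>lav_add_period\<close>, a row \<open>x < M\<close> repeats itself from its
  first \<open>M\<close> on.\<close>

definition row_period :: "nat \<Rightarrow> nat \<Rightarrow> nat \<Rightarrow> bool" where
  "row_period M x m \<longleftrightarrow> 0 < m \<and> lav M x m = M \<and> (\<forall>k. 0 < k \<and> k < m \<longrightarrow> lav M x k \<noteq> M)"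

lemma row_period_le: "row_period M x m \<Longrightarrow> x < M \<Longrightarrow> x + m \<le> M"
  using lav_increasing[of x M m] by (auto simp: row_period_def)

section \<open>Tables whose size is a period of every row\<close>

text \<open>Row periods will be determined by induction on the size. Facts about size
  \<open>N\<close>, and about size \<open>2 * N\<close> as seen from \<open>N\<close>, therefore
  rest on this assumption about \<open>N\<close> alone.\<close>

locale laver_table =
  fixes N :: nat
  assumes pos: "0 < N"
    and lav_last: "0 < x \<Longrightarrow> x \<le> N \<Longrightarrow> lav N x N = N"
begin

lemma column_cong:
  assumes "0 < x" "x \<le> N" "y mod N = z mod N"
  shows "lav N x y = lav N x z"
proof (cases "x = N")
  case True
  then show ?thesis using pmod_cong[OF assms(3)] by (simp add: lav_top)
next
  case False
  then have "x < N" using assms by simp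
  then have "lav N x w = lav N x (w mod N)" for w
    using lav_add_period_mult[of x N N "w div N" "w mod N"] lav_last[of x] assms by simp
  then show ?thesis using assms(3) by metis
qed

lemma column_pmod: "0 < x \<Longrightarrow> x \<le> N \<Longrightarrow> lav N x (y pmod N) = lav N x y"
  by (rule column_cong) auto

lemma lav_one: "0 < x \<Longrightarrow> x \<le> N \<Longrightarrow> lav N x (Suc 0) = (x + 1) pmod N"
  using pmod_cong[OF mod_add_self1[of N "Suc 0"]]
  by (cases "x = N") (simp_all add: lav_top lav_1 pmod_id[of "Suc x"])

text \<open>Extends \<open>lav_Suc\<close> to the last row, where column \<open>N + 1\<close> counts
  as column 1.\<close>

lemma lav_step:
  assumes "0 < x" "x \<le> N"
  shows "lav N x (Suc y) = lav N (lav N x y) (x + 1)"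
proof (cases "x = N")
  case True
  have "lav N (y pmod N) (N + 1) = lav N (y pmod N) (Suc 0)"
    using pos mod_add_self1[of N "Suc 0"] by (intro column_cong) (simp_all add: pmod_bounds)
  also have "\<dots> = Suc y pmod N"
    using pos by (auto simp: lav_one pmod_bounds intro!: pmod_cong)
       (metis mod_Suc_eq pmod_mod)
  finally show ?thesis using True by (simp add: lav_top)
qed (use assms in \<open>simp add: lav_Suc\<close>)

text \<open>After expanding \<open>lav N y z\<close> by the recursion, three instances of the
  induction hypothesis suffice: one raises \<open>y\<close>, one lowers \<open>z\<close>, one raises
  \<open>x\<close>.\<close>

lemma selfdistrib:
  assumes "0 < x" "x \<le> N" "0 < y" "y \<le> N"
  shows "lav N x (lav N y z) = lav N (lav N x y) (lav N x z)"
  using assms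
proof (induction "(N - x, N - y, z)" arbitrary: x y z
    rule: wf_induct_rule[OF wf_lex_prod[OF wf_less_than wf_lex_prod[OF wf_less_than wf_less_than]]])
  case (1 x y z)
  note IH = 1(1) and xy = 1(2-5)
  note [simp] = lav_le[OF pos] lav_pos[OF pos]
  consider "x = N" | "y = N" | "z = 0" | z' where "x < N" "y < N" "z = Suc z'"
    using xy by (metis le_neq_implies_less not0_implies_Suc)
  then show ?case
  proof cases
    case 1
    then show ?thesis using xy by (simp add: lav_top pmod_id column_pmod)
  next
    case 2
    then show ?thesis using xy by (simp add: lav_top pmod_id column_pmod lav_last)
  next
    case 3
    then show ?thesis using xy by (simp add: lav_0 lav_last)
  next
    case (4 z')
    have "lav N x (lav N y z) = lav N x (lav N (lav N y z') (y + 1))"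
      using 4 by (simp add: lav_Suc)
    also have "\<dots> = lav N (lav N x (lav N y z')) (lav N x (y + 1))"
      using 4 xy lav_greater[of y N z'] by (intro IH) auto
    also have "lav N x (lav N y z') = lav N (lav N x y) (lav N x z')"
      using 4 xy by (intro IH) auto
    also have "lav N x (y + 1) = lav N (lav N x y) (x + 1)"
      using 4 by (simp add: lav_Suc)
    also have "lav N (lav N (lav N x y) (lav N x z')) (lav N (lav N x y) (x + 1))
        = lav N (lav N x y) (lav N (lav N x z') (x + 1))"
      using 4 xy lav_greater[of x N y] by (intro IH[symmetric]) auto
    also have "lav N (lav N x z') (x + 1) = lav N x z"
      using 4 by (simp add: lav_Suc)
    finally show ?thesis .
  qed
qed

text \<open>Selfdistributivity carries each recursion step of row \<open>y\<close> through row
  \<open>x\<close>, where it becomes a recursion step of row \<open>u\<close>.\<close>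

lemma composition:
  assumes "0 < x" "x \<le> N" "0 < y" "y \<le> N" "0 < u" "u \<le> N"
    and u: "(u + 1) pmod N = lav N x (y + 1)"
  shows "lav N u z = lav N x (lav N y z)"
proof (induction z)
  case 0
  then show ?case using assms by (simp add: lav_0 lav_last)
next
  case (Suc z)
  note [simp] = lav_le[OF pos] lav_pos[OF pos]
  have "lav N u (Suc z) = lav N (lav N x (lav N y z)) (lav N x (y + 1))"
    using assms Suc column_pmod[of "lav N u z" "u + 1"] lav_step[of u z] by simp
  also have "\<dots> = lav N x (lav N (lav N y z) (y + 1))"
    using assms by (intro selfdistrib[symmetric]) auto
  finally show ?case using assms lav_step[of y z] by simp
qed

section \<open>Comparison of the sizes \<open>N\<close> and \<open>2 * N\<close>\<close>

text \<open>Induction along the recursion of the larger table; in the smaller one only the residue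
  of column \<open>x + 1\<close> matters.\<close>

lemma projection:
  assumes "0 < x" "x \<le> 2 * N"
  shows "lav (2 * N) x y pmod N = lav N (x pmod N) y"
  using assms
proof (induction "(2 * N - x, y)" arbitrary: x y
    rule: wf_induct_rule[OF wf_lex_prod[OF wf_less_than wf_less_than]])
  case (1 x y)
  note IH = 1(1) and x = 1(2,3)
  have NN: "(2 * N) pmod N = N" by (simp add: pmod_def)
  note [simp] = pmod_bounds[OF pos]
  consider "x = 2 * N" | "x < 2 * N" "y = 0" | y' where "x < 2 * N" "y = Suc y'"
    using x by (metis le_neq_implies_less not0_implies_Suc)
  then show ?case
  proof cases
    case 1
    then show ?thesis by (simp add: lav_top NN pmod_pmod_dvd)
  next
    case 2
    then show ?thesis by (simp add: lav_0 NN)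
  next
    case (3 y')
    let ?z = "lav (2 * N) x y'"
    have z: "x < ?z" "?z \<le> 2 * N" using 3 lav_greater lav_le pos by auto
    have "lav (2 * N) x y pmod N = lav (2 * N) ?z (x + 1) pmod N"
      using 3 by (simp add: lav_Suc)
    also have "\<dots> = lav N (?z pmod N) (x + 1)"
      using 3 z by (intro IH) auto
    also have "?z pmod N = lav N (x pmod N) y'"
      using 3 x by (intro IH) auto
    also have "lav N (lav N (x pmod N) y') (x + 1) = lav N (lav N (x pmod N) y') (x pmod N + 1)"
      using pos by (intro column_cong lav_pos lav_le) (auto, metis mod_Suc_eq pmod_mod)
    also have "\<dots> = lav N (x pmod N) y"
      using 3 lav_step[of "x pmod N" y'] by simp
    finally show ?thesis .
  qed
qed

text \<open>Entries of these rows exceed \<open>N\<close>, so their residues determine them.\<close>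

lemma upper_rows:
  assumes "N \<le> x" "x < 2 * N"
  shows "lav (2 * N) x y = N + lav N (x pmod N) y"
  using pmod_above[of N "lav (2 * N) x y"] projection[of x y] lav_bounds[of x "2 * N" y] assms pos
  by simp

lemma double_top_imp:
  assumes "0 < x" "x \<le> 2 * N" "lav (2 * N) x y = 2 * N"
  shows "lav N (x pmod N) y = N"
  using projection[OF assms(1,2), of y] assms(3) by (simp add: pmod_def)

lemma double_mod_top:
  assumes "0 < x" "x \<le> N" "lav N x y = N"
  shows "lav (2 * N) x y \<in> {N, 2 * N}"
proof -
  let ?v = "lav (2 * N) x y"
  have "?v pmod N = N" using projection[of x y] assms by (simp add: pmod_id)
  moreover have "0 < ?v" "?v \<le> 2 * N" using lav_pos lav_le assms pos by auto
  ultimately show ?thesis using pmod_above[of N ?v] pmod_id[of ?v N] by fastforce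
qed

text \<open>The entry in column \<open>m\<close> projects to \<open>N\<close>, so it is
  \<open>N\<close> itself. From there on up to column \<open>2 * m\<close> the entries exceed
  \<open>N\<close>, and the next one that projects to \<open>N\<close>, in column
  \<open>2 * m\<close>, must be \<open>2 * N\<close>.\<close>

lemma row_period_double:
  assumes x: "0 < x" "x < N" and m: "row_period N x m" and ne: "lav (2 * N) x m \<noteq> 2 * N"
  shows "row_period (2 * N) x (2 * m)"
proof -
  have mN: "0 < m" "lav N x m = N" and min: "\<And>k. 0 < k \<Longrightarrow> k < m \<Longrightarrow> lav N x k \<noteq> N"
    using m by (auto simp: row_period_def)
  have xp: "x pmod N = x" using x by (simp add: pmod_id)
  have am: "lav (2 * N) x m = N" using double_mod_top[of x m] x mN ne by simp
  have ne2: "lav (2 * N) x (m + k) \<noteq> 2 * N" if "0 < k" "k < m" for k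
    using double_top_imp[of x "m + k"] lav_add_period[of x N m k] min[OF that] x xp mN by auto
  have above: "N < lav (2 * N) x (m + k)" if "0 < k" "k \<le> m" for k
    using that
  proof (induction k)
    case (Suc k)
    let ?z = "lav (2 * N) x (m + k)"
    have "N \<le> ?z \<and> ?z < 2 * N"
    proof (cases "k = 0")
      case False
      then show ?thesis using Suc ne2[of k] lav_le[of "2 * N" x "m + k"] x by fastforce
    qed (use am pos in simp)
    then have "N < lav (2 * N) ?z (x + 1)" using lav_greater[of ?z "2 * N" "x + 1"] by simp
    then show ?case using x by (simp add: lav_Suc)
  qed simp
  have "lav N x (m + m) = N" using lav_add_period[of x N m m] x mN by simp
  then have "lav (2 * N) x (m + m) = 2 * N"
    using double_mod_top[of x "m + m"] above[of m] x mN by auto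
  moreover have "lav (2 * N) x k \<noteq> 2 * N" if k: "0 < k" "k < 2 * m" for k
  proof -
    consider "k < m" | "k = m" | "m < k" by linarith
    then show ?thesis
    proof cases
      case 1
      then show ?thesis using double_top_imp[of x k] min[of k] k x xp by auto
    next
      case 3
      then show ?thesis using ne2[of "k - m"] k by simp
    qed (use ne in simp)
  qed
  ultimately show ?thesis using mN by (simp add: row_period_def mult_2)
qed

lemma row_period_keep:
  assumes "0 < x" "x \<le> 2 * N" "row_period N (x pmod N) m" "lav (2 * N) x m = 2 * N"
  shows "row_period (2 * N) x m"
  using assms double_top_imp[of x] unfolding row_period_def by blast

lemma row_period_doubleD:
  assumes "0 < x" "x < N" "row_period N x m"
  shows "lav (2 * N) x (2 * m) = 2 * N"
proof (cases "lav (2 * N) x m = 2 * N")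
  case True
  then show ?thesis using lav_period_dvd_top[of x "2 * N" m "2 * m"] assms by simp
next
  case False
  then show ?thesis using row_period_double[OF assms] by (simp add: row_period_def)
qed

end

section \<open>Row periods are powers of two\<close>

lemma laver_table_if_row_periods:
  assumes "\<And>x. 0 < x \<Longrightarrow> x \<le> 2 ^ n \<Longrightarrow> \<exists>i\<le>n. row_period (2 ^ n) x (2 ^ i)"
  shows "laver_table (2 ^ n)"
proof
  fix x :: nat assume x: "0 < x" "x \<le> 2 ^ n"
  then obtain i where "i \<le> n" "row_period (2 ^ n) x (2 ^ i)" using assms by blast
  then show "lav (2 ^ n) x (2 ^ n) = 2 ^ n"
    using lav_period_dvd_top[of x "2 ^ n" "2 ^ i" "2 ^ n"] x
    by (cases "x = 2 ^ n") (auto simp: row_period_def lav_top pmod_id le_imp_power_dvd)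
qed simp

lemma row_period_power_of_two:
  "0 < x \<Longrightarrow> x \<le> 2 ^ n \<Longrightarrow> \<exists>i\<le>n. row_period (2 ^ n) x (2 ^ i)"
proof (induction n arbitrary: x)
  case 0
  then have "x = 1" by simp
  then show ?case using lav_top[of 1 1] by (auto simp: row_period_def pmod_def)
next
  case (Suc n)
  let ?N = "2 ^ n :: nat"
  interpret laver_table ?N by (rule laver_table_if_row_periods) (rule Suc.IH)
  have "0 < x pmod ?N" "x pmod ?N \<le> ?N" using pmod_bounds[of ?N x] by auto
  then obtain i where i: "i \<le> n" "row_period ?N (x pmod ?N) (2 ^ i)" using Suc.IH by blast
  have top: "lav ?N (x pmod ?N) (2 ^ i) = ?N" using i by (simp add: row_period_def)
  show ?case
  proof (cases "x = 2 * ?N")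
    case True
    have "row_period (2 * ?N) (2 * ?N) (2 * ?N)"
      by (auto simp: row_period_def lav_top pmod_id)
    then show ?thesis using True by (intro exI[of _ "Suc n"]) simp
  next
    case False
    then have lt: "x < 2 * ?N" using Suc.prems by simp
    show ?thesis
    proof (cases "lav (2 * ?N) x (2 ^ i) = 2 * ?N")
      case True
      then have "row_period (2 * ?N) x (2 ^ i)"
        using row_period_keep[of x "2 ^ i"] i lt Suc.prems by simp
      then show ?thesis using i by (intro exI[of _ i]) simp
    next
      case False
      \<comment> \<open>In the upper half, \<open>upper_rows\<close> would already give
        \<open>2 * ?N\<close> in this column.\<close>
      then have "x < ?N" using upper_rows[of x "2 ^ i"] top lt by force
      moreover from this have "row_period ?N x (2 ^ i)" using i Suc.prems by (simp add: pmod_id)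
      ultimately have "row_period (2 * ?N) x (2 * 2 ^ i)"
        using row_period_double[of x "2 ^ i"] False Suc.prems by blast
      then show ?thesis using i by (intro exI[of _ "Suc i"]) simp
    qed
  qed
qed

lemma laver_table_power_of_two: "laver_table (2 ^ n)"
  by (rule laver_table_if_row_periods) (rule row_period_power_of_two)

section \<open>Idempotents of composition\<close>

text \<open>Row \<open>e\<close> climbs by single steps up to \<open>2 ^ n\<close>: for
  \<open>0 < y < 2 ^ j\<close>, row \<open>e + y\<close> of the doubled table has a period dividing
  \<open>2 ^ j\<close> and hence \<open>e\<close>, so column \<open>e + 1\<close> acts there as
  column 1.\<close>

lemma top_minus_power_row:
  fixes n j :: nat
  defines "e \<equiv> 2 ^ n - 2 ^ j"
  assumes j: "j < n" and y: "0 < y" "y \<le> 2 ^ j"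
  shows "lav (2 * 2 ^ n) e y = e + y"
  using y
proof (induction y)
  case (Suc y)
  let ?N = "2 ^ n :: nat"
  interpret laver_table ?N by (rule laver_table_power_of_two)
  have lt: "(2 :: nat) ^ j < ?N" using j by simp
  then have e: "0 < e" "e < ?N" "e + 2 ^ j = ?N" by (auto simp: e_def)
  show ?case
  proof (cases "y = 0")
    case True
    then show ?thesis using e by (simp add: lav_1)
  next
    case False
    let ?x = "e + y"
    have x: "0 < ?x" "?x < ?N" using e Suc.prems by auto
    obtain i where i: "row_period ?N ?x (2 ^ i)"
      using row_period_power_of_two[of ?x n] x by force
    have "(2 :: nat) ^ i < 2 ^ j" using row_period_le[OF i] x e False by linarith
    then have "i < j" by simp
    then have "(2 :: nat) ^ Suc i dvd 2 ^ j" by (intro le_imp_power_dvd) simp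
    moreover have "(2 :: nat) ^ j dvd e"
      using j by (simp add: e_def le_imp_power_dvd)
    ultimately have "2 * 2 ^ i dvd e" by (metis dvd_trans power_Suc)
    moreover have "lav (2 * ?N) ?x (2 * 2 ^ i) = 2 * ?N"
      by (rule row_period_doubleD[OF x i])
    ultimately have "lav (2 * ?N) ?x (e + 1) = ?x + 1"
      using lav_period_dvd[of ?x "2 * ?N" "2 * 2 ^ i" e 1] lav_1[of ?x "2 * ?N"] x by simp
    then show ?thesis using lav_Suc[of e "2 * ?N" y] Suc False e by simp
  qed
qed simp

text \<open>Row \<open>e\<close> has period \<open>2 * 2 ^ j\<close>, modulo which
  \<open>e + 1\<close> is \<open>2 ^ j + 1\<close>. The entry is thus the one right after
  \<open>2 ^ n\<close>, namely \<open>2 ^ n + e + 1\<close>.\<close>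

lemma top_minus_power_not_idempotent:
  fixes n j :: nat
  defines "e \<equiv> 2 ^ n - 2 ^ j"
  assumes j: "j < n"
  shows "lav (2 * 2 ^ n) e (e + 1) \<noteq> e + 1"
proof -
  let ?N = "2 ^ n :: nat"
  interpret laver_table ?N by (rule laver_table_power_of_two)
  have lt: "(2 :: nat) ^ j < ?N" using j by simp
  then have e: "0 < e" "e < ?N" "e + 2 ^ j = ?N" by (auto simp: e_def)
  obtain i where i: "row_period ?N e (2 ^ i)"
    using row_period_power_of_two[of e n] e by force
  have "(2 :: nat) ^ i \<le> 2 ^ j" using row_period_le[OF i] e by linarith
  then have "i \<le> j" by simp
  moreover have "lav (2 * ?N) e (2 * 2 ^ i) = 2 * ?N"
    by (rule row_period_doubleD[OF e(1,2) i])
  ultimately have period: "lav (2 * ?N) e (2 * 2 ^ j) = 2 * ?N"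
    using lav_period_dvd_top[of e "2 * ?N" "2 * 2 ^ i" "2 * 2 ^ j"] e
    by (simp add: le_imp_power_dvd)
  have "lav (2 * ?N) e (2 ^ j) = ?N"
    using top_minus_power_row[of j n "2 ^ j"] j e by (simp add: e_def)
  then have "lav (2 * ?N) e (2 ^ j + 1) = lav (2 * ?N) ?N (e + 1)"
    using e by (simp add: lav_Suc)
  also have "\<dots> = ?N + e + 1"
    using upper_rows[of ?N "e + 1"] e by (simp add: lav_top pmod_id)
  finally have val: "lav (2 * ?N) e (2 ^ j + 1) = ?N + e + 1" .
  \<comment> \<open>\<open>e\<close> is the odd multiple \<open>2 * 2 ^ d - 1\<close> of
    \<open>2 ^ j\<close>.\<close>
  obtain d where d: "n = Suc (j + d)" using j less_iff_Suc_add by auto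
  have "e + 1 = (2 ^ d - 1) * (2 * 2 ^ j) + (2 ^ j + 1)"
    using e by (simp add: d e_def power_add algebra_simps)
  then have "lav (2 * ?N) e (e + 1) = lav (2 * ?N) e (2 ^ j + 1)"
    using lav_add_period_mult[OF _ period, of "2 ^ d - 1" "2 ^ j + 1"] e by simp
  then show ?thesis using val by simp
qed

text \<open>By \<open>composition\<close>, \<open>e\<close> composed with itself is
  \<open>lav (2 ^ n) e (e + 1) - 1\<close>, so the hypothesis is idempotence. It passes to the
  projection \<open>?d\<close>, which is then some \<open>?N - 2 ^ j\<close>; the lift
  \<open>e = ?d\<close> is excluded by \<open>top_minus_power_not_idempotent\<close>, leaving
  \<open>e = ?N + ?d\<close>.\<close>

lemma idempotent_form:
  assumes "0 < e" "e < 2 ^ n" "lav (2 ^ n) e (e + 1) = e + 1"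
  shows "\<exists>j<n. e = 2 ^ n - 2 ^ j"
  using assms
proof (induction n arbitrary: e)
  case (Suc n)
  let ?N = "2 ^ n :: nat"
  interpret laver_table ?N by (rule laver_table_power_of_two)
  have idem: "lav (2 * ?N) e (e + 1) = e + 1" using Suc.prems by simp
  show ?case
  proof (cases "e = ?N")
    case True
    then show ?thesis by (intro exI[of _ n]) simp
  next
    case False
    let ?d = "e pmod ?N"
    have d: "e = ?d \<or> e = ?N + ?d"
      using pmod_above[of ?N e] pmod_id[of e ?N] Suc.prems by (cases "e \<le> ?N") auto
    then have dlt: "0 < ?d" "?d < ?N"
      using False Suc.prems pmod_bounds[of ?N e] by auto
    have "lav ?N ?d (e + 1) = (e + 1) pmod ?N"
      using projection[of e "e + 1"] Suc.prems by simp
    also have "\<dots> = (?d + 1) pmod ?N"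
      by (rule pmod_cong) (metis mod_add_left_eq pmod_mod)
    also have "\<dots> = ?d + 1" using dlt by (simp add: pmod_id)
    also have "lav ?N ?d (e + 1) = lav ?N ?d (?d + 1)"
      using dlt by (intro column_cong) (auto, metis mod_Suc_eq pmod_mod)
    finally obtain j where j: "j < n" "?d = ?N - 2 ^ j" using Suc.IH[of ?d] dlt by blast
    then have "e \<noteq> ?d"
      using top_minus_power_not_idempotent[of j n] idem by auto
    then have "e = 2 ^ Suc n - 2 ^ j" using d j by simp
    then show ?thesis using j by (intro exI[of _ j]) simp
  qed
qed simp

section \<open>Fixed points and antisymmetry\<close>

lemma no_fixed_point_below_half:
  assumes s: "0 < s" "s < 2 * 2 ^ n" and q: "0 < q" "q \<le> 2 ^ n"
  shows "lav (2 * 2 ^ n) s q \<noteq> q"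
proof
  let ?M = "2 * 2 ^ n :: nat"
  assume fixed: "lav ?M s q = q"
  interpret laver_table ?M using laver_table_power_of_two[of "Suc n"] by simp
  define S where "S = {s. 0 < s \<and> s < ?M \<and> lav ?M s q = q}"
  have "finite S" by (rule finite_subset[of _ "{..<?M}"]) (auto simp: S_def)
  moreover have "s \<in> S" using s fixed by (simp add: S_def)
  ultimately have e: "Max S \<in> S" and max: "\<And>u. u \<in> S \<Longrightarrow> u \<le> Max S"
    by (auto intro: Max_in)
  define e where "e = Max S"
  have e: "0 < e" "e < ?M" "lav ?M e q = q" using e by (auto simp: S_def e_def)
  \<comment> \<open>\<open>u\<close> is \<open>e\<close> composed with itself. It fixes
    \<open>q\<close> as well, so maximality of \<open>e\<close> forces \<open>u = e\<close>.\<close>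
  define u where "u = lav ?M e (e + 1) - 1"
  have u: "e \<le> u" "u < ?M" "u + 1 = lav ?M e (e + 1)"
    using lav_bounds[of e ?M "e + 1"] e by (auto simp: u_def)
  then have "lav ?M u q = lav ?M e (lav ?M e q)"
    using e by (intro composition) (auto simp: pmod_id)
  then have "u \<in> S" using u e by (simp add: S_def)
  then have "lav ?M e (e + 1) = e + 1" using max[of u] u by (simp add: e_def)
  then obtain j where "j < Suc n" "e = 2 ^ Suc n - 2 ^ j"
    using idempotent_form[of e "Suc n"] e by auto
  moreover from this have "(2 :: nat) ^ j \<le> 2 ^ n" by simp
  \<comment> \<open>Since \<open>j \<le> n\<close>, \<open>e\<close> lies in the upper half, whereas
    \<open>lav_greater\<close> makes \<open>e\<close> smaller than its entry
    \<open>q\<close>.\<close>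
  ultimately have "2 ^ n \<le> e" unfolding power_Suc by linarith
  then show False using lav_greater[of e ?M q] e q by simp
qed

text \<open>The size is a free parameter, so that divisibility can be projected between
  tables.\<close>

definition rdiv :: "nat \<Rightarrow> nat \<Rightarrow> nat \<Rightarrow> bool" where
  "rdiv M q r \<longleftrightarrow> (\<exists>p. 0 < p \<and> p \<le> M \<and> lav M p q = r)"

text \<open>Every row \<open>s < 2 * 2 ^ n\<close> with \<open>0 < s\<close> has a power of two
  below \<open>2 * 2 ^ n\<close> as period. This divides \<open>2 ^ n\<close>, so column
  \<open>2 ^ n + q\<close> equals column \<open>q\<close> and \<open>s\<close> would fix
  \<open>q\<close>.\<close>

lemma not_rdiv_upper_lower:
  assumes "0 < q" "q \<le> 2 ^ n"
  shows "\<not> rdiv (2 * 2 ^ n) (2 ^ n + q) q"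
proof
  let ?N = "2 ^ n :: nat"
  assume "rdiv (2 * ?N) (?N + q) q"
  then obtain s where s: "0 < s" "s \<le> 2 * ?N" "lav (2 * ?N) s (?N + q) = q"
    by (auto simp: rdiv_def)
  have "s \<noteq> 2 * ?N" using s assms by (auto simp: lav_top pmod_id)
  then have lt: "s < 2 * ?N" using s by simp
  obtain i where i: "row_period (2 * ?N) s (2 ^ i)"
    using row_period_power_of_two[of s "Suc n"] s by auto
  have "(2 :: nat) ^ i < 2 ^ Suc n" using row_period_le[OF i lt] s by simp
  then have "i < Suc n" by (rule power_less_imp_less_exp[rotated]) simp
  then have "(2 :: nat) ^ i dvd ?N" by (intro le_imp_power_dvd) simp
  then have "lav (2 * ?N) s q = q"
    using lav_period_dvd[of s "2 * ?N" "2 ^ i" ?N q] i lt s by (simp add: row_period_def)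
  then show False using no_fixed_point_below_half[of s n q] lt s assms by simp
qed

text \<open>By induction both elements have the same projection. If distinct they differ by
  \<open>2 ^ n\<close>, and one of the two divisibilities contradicts
  \<open>not_rdiv_upper_lower\<close>.\<close>

lemma rdiv_antisym:
  assumes "0 < q" "q \<le> 2 ^ n" "0 < r" "r \<le> 2 ^ n" "rdiv (2 ^ n) q r" "rdiv (2 ^ n) r q"
  shows "q = r"
  using assms
proof (induction n arbitrary: q r)
  case (Suc n)
  let ?N = "2 ^ n :: nat"
  interpret laver_table ?N by (rule laver_table_power_of_two)
  have project: "rdiv ?N (a pmod ?N) (b pmod ?N)" if ab: "rdiv (2 * ?N) a b" for a b
  proof -
    obtain p where p: "0 < p" "p \<le> 2 * ?N" "lav (2 * ?N) p a = b"
      using ab by (auto simp: rdiv_def)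
    then have "lav ?N (p pmod ?N) (a pmod ?N) = b pmod ?N"
      using projection[of p a] by (simp add: column_pmod pmod_bounds)
    then show ?thesis using pmod_bounds[of ?N p] unfolding rdiv_def by auto
  qed
  have eq: "q pmod ?N = r pmod ?N"
    using Suc.prems project by (intro Suc.IH) (auto simp: pmod_bounds)
  have dec: "a = a pmod ?N \<or> a = ?N + a pmod ?N" if "0 < a" "a \<le> 2 * ?N" for a
    using that pmod_above[of ?N a] pmod_id[of a ?N] by (cases "a \<le> ?N") auto
  have no: "\<not> rdiv (2 * ?N) (?N + q pmod ?N) (q pmod ?N)"
    by (rule not_rdiv_upper_lower) (auto simp: pmod_bounds)
  show ?case
    using dec[of q] dec[of r] eq no Suc.prems by (metis power_Suc)
qed simp

section \<open>Existence and uniqueness of the operation\<close>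

text \<open>The two laws force the recursion that defines \<open>lav\<close>.\<close>

lemma is_laver_op_unique:
  assumes g: "is_laver_op n g"
    and "0 < x" "x \<le> 2 ^ n" "0 < y" "y \<le> 2 ^ n"
  shows "g x y = lav (2 ^ n) x y"
proof -
  let ?N = "2 ^ n :: nat"
  have one: "g x 1 = (x + 1) pmod ?N" if "0 < x" "x \<le> ?N" for x
    using g that by (auto simp: is_laver_op_def laver_carrier_def)
  have step: "g x (g y 1) = g (g x y) (g x 1)" if "0 < x" "x \<le> ?N" "0 < y" "y \<le> ?N" for x y
    using g that by (auto simp: is_laver_op_def laver_carrier_def)
  have Suc_step: "g x (Suc y) = g (g x y) ((x + 1) pmod ?N)"
    if "0 < x" "x \<le> ?N" "0 < y" "Suc y \<le> ?N" for x y
    using step[of x y] one[of x] one[of y] that by (simp add: pmod_id)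
  \<comment> \<open>The last row comes first, because the descent on \<open>?N - x\<close> ends
    there.\<close>
  have top: "g ?N y = y" if "0 < y" "y \<le> ?N" for y
    using that
  proof (induction y)
    case (Suc y)
    have 1: "(?N + 1) pmod ?N = 1"
      using pmod_cong[OF mod_add_self1[of ?N 1]] by (simp add: pmod_id)
    show ?case
    proof (cases "y = 0")
      case True
      then show ?thesis using one[of ?N] 1 by simp
    next
      case False
      then show ?thesis using Suc Suc_step[of ?N y] one[of y] 1 by (simp add: pmod_id)
    qed
  qed simp
  show ?thesis using assms(2-5)
  proof (induction "(?N - x, y)" arbitrary: x y
      rule: wf_induct_rule[OF wf_lex_prod[OF wf_less_than wf_less_than]])
    case (1 x y)
    note IH = 1(1) and xy = 1(2-5)
    consider "x = ?N" | "x < ?N" "y = 1" | y' where "x < ?N" "y = Suc y'" "0 < y'"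
      using xy by (cases y; cases "x = ?N"; cases "y = 1") auto
    then show ?case
    proof cases
      case 1
      then show ?thesis using top[of y] xy by (simp add: lav_top pmod_id)
    next
      case 2
      then show ?thesis using one[of x] xy by (simp add: lav_1 pmod_id)
    next
      case (3 y')
      let ?z = "lav ?N x y'"
      have z: "x < ?z" "?z \<le> ?N" using 3 lav_bounds by auto
      have "g x y' = ?z" using 3 xy by (intro IH) auto
      moreover have "g ?z (x + 1) = lav ?N ?z (x + 1)" using 3 xy z by (intro IH) auto
      ultimately show ?thesis using Suc_step[of x y'] 3 xy by (simp add: lav_Suc pmod_id)
    qed
  qed
qed

lemma is_laver_op_exists:
  defines "f n \<equiv> restrict (\<lambda>x. restrict (lav (2 ^ n) x) (laver_carrier n)) (laver_carrier n)"
  shows "is_laver_op n (f n)"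
proof -
  let ?N = "2 ^ n :: nat"
  interpret laver_table ?N by (rule laver_table_power_of_two)
  have f: "f n x y = lav ?N x y" if "0 < x" "x \<le> ?N" "0 < y" "y \<le> ?N" for x y
    using that by (simp add: f_def laver_carrier_def)
  have one: "f n x 1 = (x + 1) pmod ?N" if "0 < x" "x \<le> ?N" for x
    using that by (simp add: f lav_one)
  have "f n x (f n y 1) = f n (f n x y) (f n x 1)"
    if xy: "0 < x" "x \<le> ?N" "0 < y" "y \<le> ?N" for x y
  proof -
    have "f n x (f n y 1) = lav ?N x (Suc y)"
      unfolding one[OF xy(3,4)] using xy column_pmod[of x "y + 1"] by (simp add: f pmod_bounds)
    also have "\<dots> = lav ?N (lav ?N x y) ((x + 1) pmod ?N)"
      using xy lav_step[of x y] column_pmod[of "lav ?N x y" "x + 1"] lav_le lav_pos by simp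
    also have "\<dots> = f n (f n x y) (f n x 1)"
      unfolding one[OF xy(1,2)] using xy by (simp add: f pmod_bounds lav_le lav_pos)
    finally show ?thesis .
  qed
  moreover have "f n \<in> laver_carrier n \<rightarrow>\<^sub>E laver_carrier n \<rightarrow>\<^sub>E laver_carrier n"
    using lav_pos[of ?N] lav_le[of ?N]
    by (auto simp: f_def laver_carrier_def Suc_le_eq)
  ultimately show ?thesis
    using one by (auto simp: is_laver_op_def laver_carrier_def Suc_le_eq)
qed

text \<open>Existence and uniqueness give the \<open>THE\<close> in \<open>laver_op\<close> its
  meaning; extensionality turns agreement on the carrier into equality of functions.\<close>

lemma laver_op_eq_lav:
  assumes "0 < x" "x \<le> 2 ^ n" "0 < y" "y \<le> 2 ^ n"
  shows "laver_op n x y = lav (2 ^ n) x y"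
proof -
  have "\<exists>!f. is_laver_op n f"
  proof (rule ex_ex1I)
    show "\<exists>f. is_laver_op n f" using is_laver_op_exists by blast
  next
    fix f g assume fg: "is_laver_op n f" "is_laver_op n g"
    have E: "f \<in> laver_carrier n \<rightarrow>\<^sub>E laver_carrier n \<rightarrow>\<^sub>E laver_carrier n"
      "g \<in> laver_carrier n \<rightarrow>\<^sub>E laver_carrier n \<rightarrow>\<^sub>E laver_carrier n"
      using fg by (auto simp: is_laver_op_def)
    show "f = g"
    proof (rule PiE_ext[OF E])
      fix x assume x: "x \<in> laver_carrier n"
      show "f x = g x"
      proof (rule PiE_ext[OF PiE_mem[OF E(1) x] PiE_mem[OF E(2) x]])
        fix y assume "y \<in> laver_carrier n"
        then show "f x y = g x y"
          using x is_laver_op_unique[OF fg(1), of x y] is_laver_op_unique[OF fg(2), of x y]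
          by (simp add: laver_carrier_def)
      qed
    qed
  qed
  then have "is_laver_op n (laver_op n)" unfolding laver_op_def by (rule theI')
  then show ?thesis using assms by (rule is_laver_op_unique)
qed

section \<open>The partial ordering and its extreme elements\<close>

lemma laver_rel_iff:
  "(q, r) \<in> laver_rel n \<longleftrightarrow> 0 < q \<and> q \<le> 2 ^ n \<and> 0 < r \<and> r \<le> 2 ^ n \<and> rdiv (2 ^ n) q r"
  using laver_op_eq_lav[of _ n q]
  by (auto simp: laver_rel_def laver_carrier_def rdiv_def Bex_def Suc_le_eq)

theorem proposition4p2:
  fixes n :: nat
  shows "partial_order_on {1..2 ^ n} (laver_rel n) \<and>
    (\<forall>p \<in> {1..2 ^ n}. (1, p) \<in> laver_rel n \<and> (p, 2 ^ n) \<in> laver_rel n)"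
proof -
  let ?N = "2 ^ n :: nat"
  interpret laver_table ?N by (rule laver_table_power_of_two)
  \<comment> \<open>Provides the \<open>u\<close> that \<open>composition\<close> asks for;
    \<open>v = 1\<close> wraps around to \<open>?N\<close>.\<close>
  have successor: "\<exists>u. 0 < u \<and> u \<le> ?N \<and> (u + 1) pmod ?N = v" if "0 < v" "v \<le> ?N" for v
  proof (cases "v = 1")
    case True
    then show ?thesis
      using pmod_cong[OF mod_add_self1[of ?N 1]] by (intro exI[of _ ?N]) (simp add: pmod_id)
  next
    case False
    then show ?thesis using that by (intro exI[of _ "v - 1"]) (simp add: pmod_id)
  qed
  have refl: "rdiv ?N q q" if "0 < q" "q \<le> ?N" for q
    unfolding rdiv_def using that by (intro exI[of _ ?N]) (simp add: lav_top pmod_id)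
  have trans: "rdiv ?N p r" if pqr: "rdiv ?N p q" "rdiv ?N q r" for p q r
  proof -
    obtain x y where xy: "0 < y" "y \<le> ?N" "lav ?N y p = q" "0 < x" "x \<le> ?N" "lav ?N x q = r"
      using pqr by (auto simp: rdiv_def)
    obtain u where "0 < u" "u \<le> ?N" "(u + 1) pmod ?N = lav ?N x (y + 1)"
      using successor[of "lav ?N x (y + 1)"] lav_pos lav_le xy by auto
    then show ?thesis using composition[of x y u p] xy by (auto simp: rdiv_def)
  qed
  have initial: "rdiv ?N 1 p" if p: "0 < p" "p \<le> ?N" for p
    using successor[OF p] lav_one unfolding rdiv_def by force
  \<comment> \<open>Row \<open>?N - 1\<close> is constantly \<open>?N\<close>, the only larger
    value. For \<open>?N = 1\<close> that row would be row 0, outside the carrier.\<close>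
  have final: "rdiv ?N p ?N" if p: "0 < p" "p \<le> ?N" for p
  proof (cases "?N = 1")
    case True
    then have "p = ?N" using p by linarith
    then show ?thesis using refl[OF p] by simp
  next
    case False
    then have "0 < ?N - 1" "?N - 1 < ?N" using pos by linarith+
    moreover from this have "lav ?N (?N - 1) p = ?N"
      using lav_bounds[of "?N - 1" ?N p] by linarith
    ultimately show ?thesis unfolding rdiv_def by (intro exI[of _ "?N - 1"]) simp
  qed
  have "partial_order_on {1..?N} (laver_rel n)"
    unfolding partial_order_on_def preorder_on_def
  proof (intro conjI)
    show "laver_rel n \<subseteq> {1..?N} \<times> {1..?N}" by (auto simp: laver_rel_iff)
    show "refl_on {1..?N} (laver_rel n)"
      using refl by (auto simp: refl_on_def laver_rel_iff)
    show "trans (laver_rel n)"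
      using trans by (auto simp: trans_def laver_rel_iff)
    show "antisym (laver_rel n)"
      using rdiv_antisym by (auto simp: antisym_def laver_rel_iff)
  qed
  then show ?thesis using initial final by (auto simp: laver_rel_iff)
qed

end
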